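(* Let $I$ be an open interval in $\mathbb{R}$, let $\xi_0\in I$, and let $\phi:I\to\mathbb{R}$ be a function. If $f:m_{\approx}(I)\to\widehat{\mathbb{R}}$ is an indiscernible extension of $\phi$, and $f$ is differentiable at $\xi_0$, then $$(\forall x\in m_{\approx}(\xi_0))\quad f(x)=f(\xi_0)+f'(\xi_0)\,dx.$$
   Context: $\widehat{\mathbb{R}}$ is the set of all convergent sequences of real numbers; a real number is identified with the corresponding constant sequence, so $\mathbb{R}\subseteq\widehat{\mathbb{R}}$. $\sigma x\in\mathbb{R}$ is the limit of $x$; $x\approx y$ means $\sigma x=\sigma y$; $dx:=x-\sigma x$. For $x=(\xi_n),y=(\eta_n)$: $x+y:=(\xi_n+\eta_n)$, $xy:=(\sigma x\,\eta_n+\sigma y\,\xi_n-\sigma x\,\sigma y)$. $m_{\approx}(x):=\{y\in\widehat{\mathbb{R}}\mid y\approx x\}$ and, for a set $A\subseteq\widehat{\mathbb{R}}$, $m_{\approx}(A):=\bigcup_{x\in A}m_{\approx}(x)$. A function $f:m_{\approx}(I)\to\widehat{\mathbb{R}}$ is an indiscernible extension of $\phi:I\to\mathbb{R}$ iff $f(\sigma x)=\phi(\sigma x)$ and $f(x)\approx\phi(\sigma x)$ for all $x\in m_{\approx}(I)$. Such an $f$ is differentiable at $\xi_0\in I$ iff there is a real number $\alpha$ with $f(x)=\phi(\xi_0)+\alpha\,dx$ for all $x\in m_{\approx}(\xi_0)$, with the proviso that $\alpha=\lim_{\xi\to\xi_0}\frac{\phi(\xi)-\phi(\xi_0)}{\xi-\xi_0}$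 whenever this (usual) limit exists in $\mathbb{R}$. This $\alpha$ is unique and, for each $x\in m_{\approx}(\xi_0)$, it is called the derivative of $f$ at $x$ and denoted $f'(x)$. *)

theory Defs
  imports "HOL-Analysis.Analysis"
begin

typedef rhat = "{X :: nat \<Rightarrow> real. convergent X}"
  morphisms seq_of Rhat
  by (auto intro: exI[of _ "\<lambda>_. 0"] convergent_const)

setup_lifting type_definition_rhat

text \<open>The identification of a real number with the corresponding constant sequence.\<close>

lift_definition hat :: "real \<Rightarrow> rhat" is "\<lambda>c _. c"
  by (rule convergent_const)

lift_definition \<sigma> :: "rhat \<Rightarrow> real" is lim .

text \<open>
  The product is not the termwise one: up to the infinitesimal-by-infinitesimal term,
  which is dropped, it is the expansion of \<open>(\<sigma> x + dx) (\<sigma> y + dy)\<close>.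
  Negation and subtraction are those of the additive group, i.e. termwise; this agrees with
  \<open>x + (-1) y\<close> for the product above.
\<close>

instantiation rhat :: comm_ring_1
begin

lift_definition zero_rhat :: rhat is "\<lambda>_. 0"
  by (rule convergent_const)

lift_definition one_rhat :: rhat is "\<lambda>_. 1"
  by (rule convergent_const)

lift_definition plus_rhat :: "rhat \<Rightarrow> rhat \<Rightarrow> rhat" is "\<lambda>X Y n. X n + Y n"
  by (rule convergent_add)

lift_definition uminus_rhat :: "rhat \<Rightarrow> rhat" is "\<lambda>X n. - X n"
  by (simp flip: convergent_minus_iff)

lift_definition minus_rhat :: "rhat \<Rightarrow> rhat \<Rightarrow> rhat" is "\<lambda>X Y n. X n - Y n"
  by (rule convergent_diff)

lift_definition times_rhat :: "rhat \<Rightarrow> rhat \<Rightarrow> rhat" is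
  "\<lambda>X Y n. lim X * Y n + lim Y * X n - lim X * lim Y"
  by (intro convergent_add convergent_diff convergent_mult convergent_const)

instance
proof
  have lim_add: "lim (\<lambda>n. X n + Y n) = lim X + lim Y"
    if "convergent X" "convergent Y" for X Y :: "nat \<Rightarrow> real"
    using that by (intro limI tendsto_add) (simp_all flip: convergent_LIMSEQ_iff)
  have lim_times: "lim (\<lambda>n. lim X * Y n + lim Y * X n - lim X * lim Y) = lim X * lim Y"
    if "convergent X" "convergent Y" for X Y :: "nat \<Rightarrow> real"
  proof -
    have "(\<lambda>n. lim X * Y n + lim Y * X n - lim X * lim Y)
        \<longlonglongrightarrow> lim X * lim Y + lim Y * lim X - lim X * lim Y"
      using that by (intro tendsto_intros) (simp_all flip: convergent_LIMSEQ_iff)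
    then show ?thesis by (intro limI) simp
  qed
  fix a b c :: rhat
  show "a * b * c = a * (b * c)"
    by transfer (simp only: lim_times, simp add: algebra_simps)
  show "a * b = b * a"
    by transfer (simp add: algebra_simps)
  show "1 * a = a"
    by transfer simp
  show "(a + b) * c = a * c + b * c"
    by transfer (simp add: lim_add algebra_simps)
  show "a + b + c = a + (b + c)"
    by transfer (simp add: algebra_simps)
  show "a + b = b + a"
    by transfer (simp add: algebra_simps)
  show "0 + a = a"
    by transfer simp
  show "- a + a = 0"
    by transfer simp
  show "a - b = a + - b"
    by transfer simp
  show "(0::rhat) \<noteq> 1"
    by transfer (simp add: fun_eq_iff)
qed

end

definition indisc :: "rhat \<Rightarrow> rhat \<Rightarrow> bool"  (infix "\<approx>" 50)
  where "x \<approx> y \<longleftrightarrow> \<sigma> x = \<sigma> y"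

definition differential :: "rhat \<Rightarrow> rhat"
  where "differential x = x - hat (\<sigma> x)"

definition monad :: "rhat \<Rightarrow> rhat set"
  where "monad x = {y. y \<approx> x}"

definition monad_set :: "rhat set \<Rightarrow> rhat set"
  where "monad_set A = (\<Union>x\<in>A. monad x)"

text \<open>
  Functions \<open>\<phi>\<close> on \<open>I\<close> and \<open>f\<close> on \<open>monad_set (hat ` I)\<close> are represented by total functions;
  only their values on these domains are ever constrained or used.
\<close>

definition indisc_extension :: "real set \<Rightarrow> (real \<Rightarrow> real) \<Rightarrow> (rhat \<Rightarrow> rhat) \<Rightarrow> bool"
  where "indisc_extension I \<phi> f \<longleftrightarrow>
    (\<forall>x\<in>monad_set (hat ` I).
       f (hat (\<sigma> x)) = hat (\<phi> (\<sigma> x)) \<and> f x \<approx> hat (\<phi> (\<sigma> x)))"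

definition has_hat_derivative ::
    "real set \<Rightarrow> (real \<Rightarrow> real) \<Rightarrow> (rhat \<Rightarrow> rhat) \<Rightarrow> real \<Rightarrow> real \<Rightarrow> bool"
  where "has_hat_derivative I \<phi> f \<xi>\<^sub>0 \<alpha> \<longleftrightarrow>
    (\<forall>x\<in>monad (hat \<xi>\<^sub>0). f x = hat (\<phi> \<xi>\<^sub>0) + hat \<alpha> * differential x) \<and>
    (\<forall>l. ((\<lambda>\<xi>. (\<phi> \<xi> - \<phi> \<xi>\<^sub>0) / (\<xi> - \<xi>\<^sub>0)) \<longlongrightarrow> l) (at \<xi>\<^sub>0 within I) \<longrightarrow> \<alpha> = l)"

definition hat_differentiable ::
    "real set \<Rightarrow> (real \<Rightarrow> real) \<Rightarrow> (rhat \<Rightarrow> rhat) \<Rightarrow> real \<Rightarrow> bool"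
  where "hat_differentiable I \<phi> f \<xi>\<^sub>0 \<longleftrightarrow> \<xi>\<^sub>0 \<in> I \<and> (\<exists>\<alpha>. has_hat_derivative I \<phi> f \<xi>\<^sub>0 \<alpha>)"

text \<open>
  The derivative at \<open>x\<close> is the number attached to the real point \<open>\<sigma> x\<close>. It is unique since
  some \<open>x\<close> in each monad has \<open>differential x \<noteq> 0\<close>.
\<close>

definition hat_deriv :: "real set \<Rightarrow> (real \<Rightarrow> real) \<Rightarrow> (rhat \<Rightarrow> rhat) \<Rightarrow> rhat \<Rightarrow> real"
  where "hat_deriv I \<phi> f x = (THE \<alpha>. has_hat_derivative I \<phi> f (\<sigma> x) \<alpha>)"

end

theory Submission
  imports Defs
begin

text \<open>Differentiability already gives f(x) = \<phi>(c) + \<alpha> dx on the monad of c. Two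
  identifications remain. The extension property at the constant sequence c turns \<phi>(c) into
  f(c). That \<alpha> is the value of the definite description \<open>hat_deriv\<close> needs
  uniqueness (\<open>has_hat_derivative_unique\<close>): multiplying by a real scales every term, so
  a single dx with a nonzero term determines \<alpha>.\<close>

lemma \<sigma>_hat [simp]: "\<sigma> (hat c) = c"
  by transfer simp

lemma monad_hat_iff: "x \<in> monad (hat c) \<longleftrightarrow> \<sigma> x = c"
  by (simp add: monad_def indisc_def)

text \<open>For a constant factor the limit terms of the product, \<open>c * lim x\<close> and
  \<open>lim x * c\<close>, cancel, leaving termwise scaling.\<close>

lemma seq_of_hat_times: "seq_of (hat c * x) n = c * seq_of x n"
  by transfer (simp add: algebra_simps)

lemma ex_seq_of_differential_nonzero:
  obtains x where "x \<in> monad (hat c)" "seq_of (differential x) 0 \<noteq> 0"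
proof -
  \<comment> \<open>Any sequence tending to \<open>c\<close> with initial term other than
    \<open>c\<close> would do. With \<open>Suc n\<close> the initial term is \<open>c + 1\<close>;
    with \<open>n\<close> it would be \<open>c\<close>, as \<open>1 / 0 = 0\<close>.\<close>
  define X where "X n = c + 1 / real (Suc n)" for n
  have X: "X \<longlonglongrightarrow> c"
    unfolding X_def using tendsto_add[OF tendsto_const[of c] LIMSEQ_Suc[OF lim_1_over_n]]
    by simp
  then have conv: "convergent X"
    by (rule convergentI)
  have seq: "seq_of (Rhat X) = X"
    by (rule Rhat_inverse) (simp add: conv)
  then have \<sigma>: "\<sigma> (Rhat X) = c"
    using X by (simp add: \<sigma>.rep_eq limI)
  then have "seq_of (differential (Rhat X)) 0 \<noteq> 0"
    by (simp add: differential_def minus_rhat.rep_eq hat.rep_eq seq X_def)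
  with \<sigma> that show thesis
    by (simp add: monad_hat_iff)
qed

lemma has_hat_derivative_unique:
  assumes "has_hat_derivative I \<phi> f c \<alpha>" "has_hat_derivative I \<phi> f c \<beta>"
  shows "\<alpha> = \<beta>"
proof -
  obtain x where x: "x \<in> monad (hat c)" and nz: "seq_of (differential x) 0 \<noteq> 0"
    by (rule ex_seq_of_differential_nonzero)
  have "hat (\<phi> c) + hat \<alpha> * differential x = hat (\<phi> c) + hat \<beta> * differential x"
    using assms x by (metis has_hat_derivative_def)
  then have "seq_of (hat \<alpha> * differential x) 0 = seq_of (hat \<beta> * differential x) 0"
    by simp
  with nz show ?thesis
    by (simp add: seq_of_hat_times)
qed

text \<open>Existence and uniqueness together let \<open>THE\<close> in \<open>hat_deriv\<close>
  denote an actual derivative.\<close>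

lemma has_hat_derivative_hat_deriv:
  assumes "hat_differentiable I \<phi> f c"
  shows "has_hat_derivative I \<phi> f c (hat_deriv I \<phi> f (hat c))"
proof -
  have "\<exists>!\<alpha>. has_hat_derivative I \<phi> f c \<alpha>"
    using assms has_hat_derivative_unique by (auto simp: hat_differentiable_def)
  then show ?thesis
    unfolding hat_deriv_def by (simp add: theI')
qed

theorem proposition5p20:
  fixes I :: "real set" and \<xi>\<^sub>0 :: real and \<phi> :: "real \<Rightarrow> real" and f :: "rhat \<Rightarrow> rhat"
  assumes "open I" and "is_interval I" and "\<xi>\<^sub>0 \<in> I"
    and "indisc_extension I \<phi> f"
    and "hat_differentiable I \<phi> f \<xi>\<^sub>0"
  shows "\<forall>x\<in>monad (hat \<xi>\<^sub>0).
    f x = f (hat \<xi>\<^sub>0) + hat (hat_deriv I \<phi> f (hat \<xi>\<^sub>0)) * differential x"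
proof -
  have "hat \<xi>\<^sub>0 \<in> monad_set (hat ` I)"
    using assms(3) by (auto simp: monad_set_def monad_hat_iff)
  \<comment> \<open>The extension property is taken at the real point itself, where \<sigma> returns
    \<open>\<xi>\<^sub>0\<close>.\<close>
  then have "f (hat \<xi>\<^sub>0) = hat (\<phi> \<xi>\<^sub>0)"
    using assms(4) by (force simp: indisc_extension_def)
  then show ?thesis
    using has_hat_derivative_hat_deriv[OF assms(5)] by (simp add: has_hat_derivative_def)
qed

end
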